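(* Let $\varphi:\mathbb{F}_\infty\to\mathbb{R}$ be a function such that $\varphi(g)$ depends only on $\|g\|_2$, with $\varphi(e)=1$. The following are equivalent: (1) $\varphi$ is positive definite on $\mathbb{F}_\infty$; (2) there is a Borel probability measure $\mu$ on $[-1,1]$ such that $\varphi(g)=\int_{-1}^1 s^{\|g\|_2^2}\,d\mu(s)$ for all $g\in\mathbb{F}_\infty$ (with $0^0=1$). Moreover, if (2) holds, then $\mu$ is uniquely determined by $\varphi$.
   Context: $\mathbb{F}_\infty$ is the free group on countably infinitely many free generators. Every $g\ne e$ has a unique reduced form $g = a_1^{k_1}\cdots a_n^{k_n}$ with $a_j$ free generators, $a_j\neq a_{j+1}$, $k_j\in\mathbb{Z}\setminus\{0\}$; $\|g\|_2 := (\sum_{j} k_j^2)^{1/2}$, $\|e\|_2=0$. A function $\varphi$ on a group is positive definite if $\sum_{j,k=1}^n c_j\overline{c_k}\varphi(x_j^{-1}x_k)\ge0$ for all $n$, $x_i$ in the group, $c_i\in\mathbb{C}$. *)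

theory Defs
  imports "HOL-Probability.Probability" "HOL-Library.Complex_Order"
begin

text \<open>The free group on countably many generators (indexed by nat), realised as
  reduced words: a word is a list of pairs (generator, nonzero exponent) with
  adjacent generators distinct.\<close>

fun reduced :: "(nat \<times> int) list \<Rightarrow> bool" where
  "reduced [] = True"
| "reduced [(a, k)] = (k \<noteq> 0)"
| "reduced ((a, k) # (b, l) # ws) = (k \<noteq> 0 \<and> a \<noteq> b \<and> reduced ((b, l) # ws))"

fun push :: "nat \<times> int \<Rightarrow> (nat \<times> int) list \<Rightarrow> (nat \<times> int) list" where
  "push (a, k) [] = (if k = 0 then [] else [(a, k)])"
| "push (a, k) ((b, l) # ws) =
     (if k = 0 then (b, l) # ws
      else if a = b then (if k + l = 0 then ws else (a, k + l) # ws)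
      else (a, k) # (b, l) # ws)"

definition normalize :: "(nat \<times> int) list \<Rightarrow> (nat \<times> int) list" where
  "normalize w = foldr push w []"

lemma reduced_tl: "reduced (x # ws) \<Longrightarrow> reduced ws"
  by (cases x; cases ws) auto

lemma reduced_push: "reduced ws \<Longrightarrow> reduced (push x ws)"
proof (cases x)
  case (Pair a k)
  assume r: "reduced ws"
  show ?thesis
  proof (cases ws)
    case Nil then show ?thesis using Pair by simp
  next
    case (Cons y vs)
    obtain b l where y: "y = (b, l)" by (cases y)
    show ?thesis using r Pair Cons y
      by (cases vs) (auto dest: reduced_tl)
  qed
qed

lemma reduced_normalize: "reduced (normalize w)"
  unfolding normalize_def by (induction w) (auto intro: reduced_push)

typedef fgroup = "{w :: (nat \<times> int) list. reduced w}"
  by (rule exI[of _ "[]"]) simp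

definition fone :: fgroup where
  "fone = Abs_fgroup []"

definition fmult :: "fgroup \<Rightarrow> fgroup \<Rightarrow> fgroup" where
  "fmult g h = Abs_fgroup (normalize (Rep_fgroup g @ Rep_fgroup h))"

definition finv :: "fgroup \<Rightarrow> fgroup" where
  "finv g = Abs_fgroup (rev (map (\<lambda>(a, k). (a, - k)) (Rep_fgroup g)))"

definition norm2_sq :: "fgroup \<Rightarrow> nat" where
  "norm2_sq g = nat (\<Sum>(a, k)\<leftarrow>Rep_fgroup g. k ^ 2)"

definition norm2 :: "fgroup \<Rightarrow> real" where
  "norm2 g = sqrt (real (norm2_sq g))"

definition positive_definite :: "(fgroup \<Rightarrow> complex) \<Rightarrow> bool" where
  "positive_definite \<phi> \<longleftrightarrow>
     (\<forall>n (x :: nat \<Rightarrow> fgroup) (c :: nat \<Rightarrow> complex).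
        0 \<le> (\<Sum>j<n. \<Sum>k<n. c j * cnj (c k) * \<phi> (fmult (finv (x j)) (x k))))"

end

theory Submission
  imports Defs "HOL-Computational_Algebra.Polynomial"
begin

text \<open>
  For \<open>-1 \<le> s \<le> 1\<close> the function \<open>k \<mapsto> s ^ k\<^sup>2\<close> is positive definite on the integers: up to the factors
  \<open>s ^ k\<^sup>2\<close> and \<open>s ^ l\<^sup>2\<close>, and a sign character when \<open>s < 0\<close>, the kernel \<open>s ^ (k - l)\<^sup>2\<close> is
  the exponential of a nonnegative multiple of \<open>k l\<close>. The free product of these functions is
  \<open>s ^ \<parallel>g\<parallel>\<^sup>2\<close>; that it is positive definite follows by peeling off the first syllable of reduced
  words and taking Schur complements. Integrating over \<open>s\<close> shows that (2) implies (1).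

  Conversely, let \<open>\<phi> g = f (\<parallel>g\<parallel>\<^sup>2)\<close> be positive definite. Words on disjoint sets of generators satisfy
  \<open>\<parallel>x\<^sup>-\<^sup>1y\<parallel>\<^sup>2 = \<parallel>x\<parallel>\<^sup>2 + \<parallel>y\<parallel>\<^sup>2\<close>, and since there are infinitely many generators an averaging argument
  shows that the Hankel kernel \<open>f (m + n)\<close> is positive semidefinite. As \<open>f\<close> is bounded, the functional
  \<open>x ^ n \<mapsto> f n\<close> is nonnegative on the Bernstein polynomials of \<open>[-1, 1]\<close>. Its values on them are the
  weights of discrete measures, of which a weak limit has the moments \<open>f n\<close>. Uniqueness holds because
  the moments determine the characteristic function.
\<close>

section \<open>Positive semidefinite kernels\<close>

text \<open>Points may repeat, so the notion passes through non-injective maps, and coefficients are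
  real. Symmetry of \<open>K\<close> is not built in; it is assumed separately where it
  matters.\<close>

definition psd_on :: "'a set \<Rightarrow> ('a \<Rightarrow> 'a \<Rightarrow> real) \<Rightarrow> bool" where
  "psd_on A K \<longleftrightarrow>
     (\<forall>(n::nat) x c. (\<forall>j<n. x j \<in> A) \<longrightarrow> 0 \<le> (\<Sum>j<n. \<Sum>k<n. c j * c k * K (x j) (x k)))"

lemma psd_onI:
  assumes "\<And>(n::nat) x c. (\<And>j. j < n \<Longrightarrow> x j \<in> A) \<Longrightarrow> 0 \<le> (\<Sum>j<n. \<Sum>k<n. c j * c k * K (x j) (x k))"
  shows "psd_on A K"
  using assms unfolding psd_on_def by blast

lemma psd_onD:
  fixes n :: nat
  assumes "psd_on A K" "\<And>j. j < n \<Longrightarrow> x j \<in> A"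
  shows "0 \<le> (\<Sum>j<n. \<Sum>k<n. c j * c k * K (x j) (x k))"
  using assms unfolding psd_on_def by blast

lemma psd_on_cong:
  assumes "\<And>x y. x \<in> A \<Longrightarrow> y \<in> A \<Longrightarrow> K x y = K' x y"
  shows "psd_on A K \<longleftrightarrow> psd_on A K'"
proof -
  have "(\<Sum>j<n. \<Sum>k<n. c j * c k * K (x j) (x k)) = (\<Sum>j<n. \<Sum>k<n. c j * c k * K' (x j) (x k))"
    if "\<forall>j<n. x j \<in> A" for n :: nat and x c
    using that assms by (intro sum.cong refl) auto
  then show ?thesis unfolding psd_on_def by auto
qed

lemma psd_on_compose:
  assumes "psd_on B K" "\<And>x. x \<in> A \<Longrightarrow> f x \<in> B"
  shows "psd_on A (\<lambda>x y. K (f x) (f y))"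
proof (rule psd_onI)
  fix n :: nat and x c assume "\<And>j. j < n \<Longrightarrow> x j \<in> A"
  then show "0 \<le> (\<Sum>j<n. \<Sum>k<n. c j * c k * K (f (x j)) (f (x k)))"
    using psd_onD[OF assms(1), where n=n and x="\<lambda>j. f (x j)" and c=c] assms(2) by auto
qed

lemma psd_on_add:
  assumes "psd_on A K" "psd_on A K'"
  shows "psd_on A (\<lambda>x y. K x y + K' x y)"
proof (rule psd_onI)
  fix n :: nat and x c assume x: "\<And>j. j < n \<Longrightarrow> x j \<in> A"
  show "0 \<le> (\<Sum>j<n. \<Sum>k<n. c j * c k * (K (x j) (x k) + K' (x j) (x k)))"
    using psd_onD[OF assms(1) x, where c=c] psd_onD[OF assms(2) x, where c=c]
    by (simp add: distrib_left sum.distrib)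
qed

lemma psd_on_scale:
  assumes "psd_on A K"
  shows "psd_on A (\<lambda>x y. u x * u y * K x y)"
proof (rule psd_onI)
  fix n :: nat and x c assume x: "\<And>j. j < n \<Longrightarrow> x j \<in> A"
  show "0 \<le> (\<Sum>j<n. \<Sum>k<n. c j * c k * (u (x j) * u (x k) * K (x j) (x k)))"
    using psd_onD[OF assms x, where c="\<lambda>j. c j * u (x j)"] by (simp add: mult_ac)
qed

lemma psd_on_rank_one: "psd_on A (\<lambda>x y. u x * u y)"
proof (rule psd_onI)
  fix n :: nat and x c
  have "(\<Sum>j<n. \<Sum>k<n. c j * c k * (u (x j) * u (x k))) = (\<Sum>j<n. c j * u (x j))\<^sup>2"
    by (simp add: power2_eq_square sum_product mult_ac)
  then show "0 \<le> (\<Sum>j<n. \<Sum>k<n. c j * c k * (u (x j) * u (x k)))" by simp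
qed

text \<open>Grouping the coefficients by the value of \<open>P\<close> writes the form as a sum,
  over the finitely many classes, of forms of \<open>K\<close> itself.\<close>

lemma psd_on_same_class:
  assumes "psd_on A K"
  shows "psd_on A (\<lambda>x y. if P x = P y then K x y else 0)"
proof (rule psd_onI)
  fix n :: nat and x c assume x: "\<And>j. j < n \<Longrightarrow> x j \<in> A"
  let ?V = "(\<lambda>j. P (x j)) ` {..<n}"
  have eq: "c j * c k * (if P (x j) = P (x k) then K (x j) (x k) else 0) =
     (\<Sum>v\<in>?V. (if P (x j) = v then c j else 0) * (if P (x k) = v then c k else 0) * K (x j) (x k))"
    if "j < n" for j k
  proof -
    have "(\<Sum>v\<in>?V. (if P (x j) = v then c j else 0) * (if P (x k) = v then c k else 0) * K (x j) (x k))
      = (\<Sum>v\<in>?V. if v = P (x j) then c j * (if P (x k) = P (x j) then c k else 0) * K (x j) (x k) else 0)"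
      by (intro sum.cong) auto
    also have "\<dots> = c j * (if P (x k) = P (x j) then c k else 0) * K (x j) (x k)"
      using that by (subst sum.delta) auto
    finally show ?thesis by auto
  qed
  have "(\<Sum>j<n. \<Sum>k<n. c j * c k * (if P (x j) = P (x k) then K (x j) (x k) else 0)) =
    (\<Sum>j<n. \<Sum>k<n. \<Sum>v\<in>?V. (if P (x j) = v then c j else 0) * (if P (x k) = v then c k else 0) * K (x j) (x k))"
    using eq by (intro sum.cong refl) auto
  also have "\<dots> = (\<Sum>j<n. \<Sum>v\<in>?V. \<Sum>k<n. (if P (x j) = v then c j else 0) * (if P (x k) = v then c k else 0) * K (x j) (x k))"
    by (intro sum.cong refl sum.swap)
  also have "\<dots> = (\<Sum>v\<in>?V. \<Sum>j<n. \<Sum>k<n. (if P (x j) = v then c j else 0) * (if P (x k) = v then c k else 0) * K (x j) (x k))"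
    by (rule sum.swap)
  also have "\<dots> \<ge> 0"
    by (intro sum_nonneg psd_onD[OF assms x])
  finally show "0 \<le> (\<Sum>j<n. \<Sum>k<n. c j * c k * (if P (x j) = P (x k) then K (x j) (x k) else 0))" .
qed

text \<open>The Schur complement of the point \<open>z\<close>: append \<open>z\<close> to the family with the
  coefficient that minimises the quadratic form.\<close>

lemma psd_on_schur_complement:
  assumes "psd_on A K" "z \<in> A" "K z z = 1" "\<And>x. x \<in> A \<Longrightarrow> K z x = K x z"
  shows "psd_on A (\<lambda>x y. K x y - K x z * K y z)"
proof (rule psd_onI)
  fix n :: nat and x c assume x: "\<And>j. j < n \<Longrightarrow> x j \<in> A"
  define S where "S = (\<Sum>j<n. c j * K (x j) z)"
  define x' c' where "x' = x(n := z)" and "c' = c(n := - S)"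
  have "0 \<le> (\<Sum>j<Suc n. \<Sum>k<Suc n. c' j * c' k * K (x' j) (x' k))"
    by (rule psd_onD[OF assms(1)]) (use x assms(2) in \<open>auto simp: x'_def\<close>)
  also have "\<dots> = (\<Sum>j<n. \<Sum>k<n. c j * c k * K (x j) (x k)) + (\<Sum>j<n. c j * (- S) * K (x j) z)
      + (\<Sum>k<n. (- S) * c k * K (x k) z) + S * S"
    using x assms(3,4) by (simp add: x'_def c'_def sum.distrib sum_subtractf sum_negf)
  also have "(\<Sum>j<n. c j * (- S) * K (x j) z) = - S * S"
    by (simp add: S_def sum_distrib_left sum_distrib_right sum_negf mult_ac)
  also have "(\<Sum>k<n. (- S) * c k * K (x k) z) = - S * S"
    by (simp add: S_def sum_distrib_left sum_distrib_right sum_negf mult_ac)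
  also have "S * S = (\<Sum>j<n. \<Sum>k<n. c j * c k * (K (x j) z * K (x k) z))"
    by (simp add: S_def sum_product mult_ac)
  finally show "0 \<le> (\<Sum>j<n. \<Sum>k<n. c j * c k * (K (x j) (x k) - K (x j) z * K (x k) z))"
    by (simp add: right_diff_distrib sum_subtractf S_def sum_product mult_ac)
qed

text \<open>The exponential series splits the form into terms \<open>t ^ m / fact m\<close> times
  the square of \<open>\<Sum>j<n. c j * f (x j) ^ m\<close>.\<close>

lemma psd_on_exp_mult:
  fixes f :: "'a \<Rightarrow> real"
  assumes "0 \<le> t"
  shows "psd_on A (\<lambda>x y. exp (t * (f x * f y)))"
proof (rule psd_onI)
  fix n :: nat and x c
  have "(\<lambda>m. \<Sum>j<n. \<Sum>k<n. c j * c k * ((t * (f (x j) * f (x k))) ^ m /\<^sub>R fact m)) sums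
        (\<Sum>j<n. \<Sum>k<n. c j * c k * exp (t * (f (x j) * f (x k))))"
    by (intro sums_sum sums_mult exp_converges)
  moreover have "(\<Sum>j<n. \<Sum>k<n. c j * c k * ((t * (f (x j) * f (x k))) ^ m /\<^sub>R fact m)) =
      t ^ m / fact m * (\<Sum>j<n. c j * f (x j) ^ m)\<^sup>2" for m
    by (simp add: power2_eq_square sum_product sum_distrib_left power_mult_distrib field_simps)
  ultimately have "(\<lambda>m. t ^ m / fact m * (\<Sum>j<n. c j * f (x j) ^ m)\<^sup>2) sums
        (\<Sum>j<n. \<Sum>k<n. c j * c k * exp (t * (f (x j) * f (x k))))" by simp
  then show "0 \<le> (\<Sum>j<n. \<Sum>k<n. c j * c k * exp (t * (f (x j) * f (x k))))"
    by (rule sums_le[OF _ sums_zero, rotated]) (simp add: assms)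
qed

lemma psd_on_power_square_diff:
  fixes s :: real
  assumes "-1 \<le> s" "s \<le> 1"
  shows "psd_on UNIV (\<lambda>k l :: int. s ^ nat ((k - l)\<^sup>2))"
proof -
  have pos: "psd_on UNIV (\<lambda>k l :: int. r ^ nat ((k - l)\<^sup>2))" if "0 \<le> r" "r \<le> 1" for r :: real
  proof (cases "r = 0")
    case True
    \<comment> \<open>As \<open>0 ^ 0 = 1\<close>, the kernel for \<open>r = 0\<close> is the
      identity kernel.\<close>
    have "psd_on UNIV (\<lambda>k l :: int. if k = l then 1 * 1 else 0)"
      by (rule psd_on_same_class[of _ _ "\<lambda>k. k"]) (rule psd_on_rank_one)
    moreover have "r ^ nat ((k - l)\<^sup>2) = (if k = l then 1 * 1 else 0)" for k l :: int
      using True by (auto simp: power_0_left)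
    ultimately show ?thesis by simp
  next
    case False
    define t where "t = - ln r"
    have t: "t \<ge> 0" "r = exp (- t)" using that False by (auto simp: t_def)
    have eq: "r ^ nat ((k - l)\<^sup>2) =
        exp (- t * (real_of_int k)\<^sup>2) * exp (- t * (real_of_int l)\<^sup>2) * exp (2 * t * (real_of_int k * real_of_int l))"
      for k l :: int
    proof -
      have "real (nat ((k - l)\<^sup>2)) = (real_of_int k - real_of_int l)\<^sup>2" by simp
      then have "r ^ nat ((k - l)\<^sup>2) = exp ((real_of_int k - real_of_int l)\<^sup>2 * (- t))"
        unfolding t(2) by (metis exp_of_nat_mult)
      also have "(real_of_int k - real_of_int l)\<^sup>2 * (- t) =
         - t * (real_of_int k)\<^sup>2 + - t * (real_of_int l)\<^sup>2 + 2 * t * (real_of_int k * real_of_int l)"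
        by (simp add: power2_eq_square algebra_simps)
      finally show ?thesis by (simp only: exp_add)
    qed
    show ?thesis unfolding eq
      by (intro psd_on_scale psd_on_exp_mult) (use t in simp)
  qed
  show ?thesis
  proof (cases "s \<ge> 0")
    case True then show ?thesis using pos assms by blast
  next
    case False
    \<comment> \<open>The square of \<open>k - l\<close> has the parity of \<open>k + l\<close>, so
      the sign factors into a character of \<open>k\<close> times one of \<open>l\<close>.\<close>
    define e where "e k = (if even k then 1 else - 1 :: real)" for k :: int
    have "s ^ nat ((k - l)\<^sup>2) = e k * e l * (- s) ^ nat ((k - l)\<^sup>2)" for k l
    proof -
      have "even (nat ((k - l)\<^sup>2)) \<longleftrightarrow> (even k \<longleftrightarrow> even l)"
        by (simp add: even_nat_iff)
      then show ?thesis by (auto simp: e_def)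
    qed
    then show ?thesis using False assms by (auto intro!: psd_on_scale pos)
  qed
qed

section \<open>Powers of the norm on the free group\<close>

text \<open>Squared norm on raw lists, so that inductions on words avoid the type
  \<open>fgroup\<close>.\<close>

definition wsq :: "(nat \<times> int) list \<Rightarrow> nat" where
  "wsq w = (\<Sum>(a, k)\<leftarrow>w. nat (k\<^sup>2))"

lemma wsq_Nil [simp]: "wsq [] = 0" and wsq_Cons [simp]: "wsq ((a, k) # w) = nat (k\<^sup>2) + wsq w"
  by (simp_all add: wsq_def)

lemma norm2_sq_eq_wsq: "norm2_sq g = wsq (Rep_fgroup g)"
proof -
  have "(\<Sum>(a, k)\<leftarrow>w. k ^ 2) = int (wsq w)" for w :: "(nat \<times> int) list"
    by (induction w) auto
  then show ?thesis by (simp add: norm2_sq_def)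
qed

text \<open>For reduced \<open>y\<close>, this computes the inverse of \<open>x\<close> times
  \<open>y\<close> without reversing \<open>x\<close>: pushing the inverted syllables in order makes
  the leading syllables of \<open>x\<close> and \<open>y\<close> meet first.\<close>

definition winv_times :: "(nat \<times> int) list \<Rightarrow> (nat \<times> int) list \<Rightarrow> (nat \<times> int) list" where
  "winv_times x y = fold push (map (\<lambda>(a, k). (a, - k)) x) y"

lemma normalize_reduced: "reduced w \<Longrightarrow> normalize w = w"
proof (induction w rule: reduced.induct)
  case (3 a k b l ws)
  then have "foldr push ((b, l) # ws) [] = (b, l) # ws" by (simp add: normalize_def)
  with 3 show ?case by (simp add: normalize_def)
qed (auto simp: normalize_def)

lemma reduced_append_singleton:
  "reduced (w @ [(a, k)]) \<longleftrightarrow> reduced w \<and> k \<noteq> 0 \<and> (w = [] \<or> fst (last w) \<noteq> a)"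
  by (induction w rule: reduced.induct) auto

lemma reduced_rev_inverse: "reduced w \<Longrightarrow> reduced (rev (map (\<lambda>(a, k). (a, - k)) w))"
proof (induction w rule: reduced.induct)
  case (3 a k b l ws)
  then show ?case
    using reduced_append_singleton[of "rev (map (\<lambda>(a, k). (a, - k)) ((b, l) # ws))" a "- k"] by simp
qed auto

lemma Rep_fmult_finv:
  "Rep_fgroup (fmult (finv x) y) = winv_times (Rep_fgroup x) (Rep_fgroup y)"
proof -
  have red: "reduced (Rep_fgroup g)" for g using Rep_fgroup by auto
  have "Rep_fgroup (finv x) = rev (map (\<lambda>(a, k). (a, - k)) (Rep_fgroup x))"
    unfolding finv_def by (rule Abs_fgroup_inverse) (simp add: reduced_rev_inverse red)
  moreover have "Rep_fgroup (fmult (finv x) y) = normalize (Rep_fgroup (finv x) @ Rep_fgroup y)"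
    unfolding fmult_def by (rule Abs_fgroup_inverse) (simp add: reduced_normalize)
  moreover have "foldr push (Rep_fgroup y) [] = Rep_fgroup y"
    using normalize_reduced[OF red, of y] by (simp add: normalize_def)
  ultimately show ?thesis
    by (simp add: normalize_def winv_times_def foldr_conv_fold)
qed

text \<open>A syllable whose generator differs from that of the head of \<open>z\<close> is simply
  prepended. Reducedness of \<open>x\<close> carries this condition to the next syllable, whence the
  induction with \<open>z\<close> arbitrary.\<close>

lemma wsq_winv_times_no_cancel:
  "reduced x \<Longrightarrow> (x \<noteq> [] \<Longrightarrow> z \<noteq> [] \<Longrightarrow> fst (hd x) \<noteq> fst (hd z)) \<Longrightarrow>
    wsq (winv_times x z) = wsq x + wsq z"
proof (induction x arbitrary: z rule: reduced.induct)
  case (2 a k)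
  then show ?case by (cases z) (auto simp: winv_times_def)
next
  case (3 a k b l ws)
  have push: "push (a, - k) z = (a, - k) # z"
    using 3(2,3) by (cases z) auto
  have "wsq (winv_times ((a, k) # (b, l) # ws) z) = wsq (winv_times ((b, l) # ws) ((a, - k) # z))"
    by (simp add: winv_times_def push)
  also have "\<dots> = wsq ((b, l) # ws) + wsq ((a, - k) # z)"
    using 3(2) by (intro 3(1)) auto
  finally show ?case by simp
qed (simp add: winv_times_def)

text \<open>The first push merges the leading syllables into \<open>(a, l - k)\<close>; as
  \<open>l - k\<close> is nonzero and the next generator of \<open>x\<close> is not
  \<open>a\<close>, nothing cancels afterwards.\<close>

lemma wsq_winv_times_same:
  assumes "reduced ((a, k) # x)" "reduced ((a, l) # y)" "k \<noteq> l"
  shows "wsq (winv_times ((a, k) # x) ((a, l) # y)) = nat ((k - l)\<^sup>2) + wsq x + wsq y"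
proof -
  have k: "k \<noteq> 0" and x: "x \<noteq> [] \<Longrightarrow> fst (hd x) \<noteq> a" "reduced x"
    using assms(1) by (cases x; auto)+
  have "winv_times ((a, k) # x) ((a, l) # y) = winv_times x ((a, l - k) # y)"
    using k assms(3) by (simp add: winv_times_def)
  moreover have "wsq (winv_times x ((a, l - k) # y)) = wsq x + wsq ((a, l - k) # y)"
    using x by (intro wsq_winv_times_no_cancel) auto
  ultimately show ?thesis by (simp add: power2_commute)
qed

lemma winv_times_cancel:
  assumes "reduced ((a, k) # x)"
  shows "winv_times ((a, k) # x) ((a, k) # y) = winv_times x y"
proof -
  have "k \<noteq> 0" using assms by (cases x) auto
  then show ?thesis by (simp add: winv_times_def)
qed

lemma winv_times_self: "reduced x \<Longrightarrow> winv_times x x = []"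
  by (induction x rule: reduced.induct)
     (auto simp: winv_times_cancel, auto simp: winv_times_def)

text \<open>The two words are inverse to each other; the proof compares leading syllables. This
  gives the symmetry of the kernels on the group.\<close>

lemma wsq_winv_times_commute:
  assumes "reduced x" "reduced y"
  shows "wsq (winv_times x y) = wsq (winv_times y x)"
  using assms
proof (induction x arbitrary: y)
  case (Cons p x)
  obtain a k where p: "p = (a, k)" by (cases p)
  show ?case
  proof (cases "y = [] \<or> fst (hd y) \<noteq> a")
    case True
    then show ?thesis using Cons.prems
      by (subst (1 2) wsq_winv_times_no_cancel) (auto simp: p)
  next
    case False
    then obtain l y' where y: "y = (a, l) # y'" by (cases y) auto
    show ?thesis
    proof (cases "k = l")
      case True
      then show ?thesis
        using Cons.IH[of y'] Cons.prems unfolding p y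
        by (auto simp: winv_times_cancel dest: reduced_tl)
    next
      case False
      then show ?thesis using Cons.prems unfolding p y
        by (simp add: wsq_winv_times_same power2_commute)
    qed
  qed
next
  case Nil
  then show ?case
    by (subst (1 2) wsq_winv_times_no_cancel) auto
qed

text \<open>The subtracted term makes the induction work: the kernel is the Schur complement at the
  empty word, and it vanishes unless both words are nonempty with the same first generator
  \<open>a\<close>. Then, for \<open>(a, k) # x\<close> and \<open>(a, l) # y\<close>, it equals
  \<open>s ^ wsq x * s ^ wsq y\<close> times the Schur complement \<open>K k l\<close> on the
  integers, plus, when \<open>k = l\<close>, the same kernel at the shorter words \<open>x\<close>
  and \<open>y\<close>.\<close>

lemma psd_on_word_power_diff:
  fixes s :: real
  assumes s: "-1 \<le> s" "s \<le> 1"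
  shows "psd_on {w. reduced w \<and> length w \<le> n}
           (\<lambda>x y. s ^ wsq (winv_times x y) - s ^ wsq x * s ^ wsq y)"
proof (induction n)
  case 0
  show ?case by (rule psd_onI) (simp add: winv_times_def sum_nonneg)
next
  case (Suc n)
  let ?D = "\<lambda>x y. s ^ wsq (winv_times x y) - s ^ wsq x * s ^ wsq y"
  let ?A = "{w. reduced w \<and> length w \<le> n}" and ?A' = "{w. reduced w \<and> length w \<le> Suc n}"
  define u where "u x = s ^ wsq (tl x)" for x
  \<comment> \<open>\<open>g\<close> removes the empty word, at which the kernel is zero while
    \<open>hd\<close> is unspecified.\<close>
  define g where "g x = (if x = [] then 0 else 1 :: real)" for x :: "(nat \<times> int) list"
  define \<kappa> where "\<kappa> x = snd (hd x)" for x :: "(nat \<times> int) list"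
  \<comment> \<open>Schur complement at \<open>0\<close> of the integer kernel; \<open>k - 0\<close>
    is left unsimplified to match \<open>psd_on_schur_complement\<close>.\<close>
  define K where "K k l = s ^ nat ((k - l)\<^sup>2) - s ^ nat ((k - 0)\<^sup>2) * s ^ nat ((l - 0)\<^sup>2)" for k l :: int
  have K: "psd_on UNIV K"
    unfolding K_def by (intro psd_on_schur_complement psd_on_power_square_diff s) (auto simp: power2_commute)
  have "psd_on ?A' (\<lambda>x y. g x * g y * (if fst (hd x) = fst (hd y)
       then (if \<kappa> x = \<kappa> y then ?D (tl x) (tl y) else 0) + u x * u y * K (\<kappa> x) (\<kappa> y) else 0))"
    by (intro psd_on_scale psd_on_same_class psd_on_add psd_on_compose[OF Suc] psd_on_compose[OF K])
       (auto, metis list.sel(2) list.exhaust_sel reduced_tl)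
  also have "?this \<longleftrightarrow> psd_on ?A' ?D"
  proof (rule psd_on_cong)
    fix x y assume xy: "x \<in> ?A'" "y \<in> ?A'"
    show "g x * g y * (if fst (hd x) = fst (hd y)
       then (if \<kappa> x = \<kappa> y then ?D (tl x) (tl y) else 0) + u x * u y * K (\<kappa> x) (\<kappa> y) else 0) = ?D x y"
    proof (cases "x = [] \<or> y = [] \<or> fst (hd x) \<noteq> fst (hd y)")
      case True
      then have "wsq (winv_times x y) = wsq x + wsq y"
        using xy by (intro wsq_winv_times_no_cancel) auto
      then show ?thesis using True by (auto simp: g_def power_add)
    next
      case False
      then obtain a k l x' y' where eq: "x = (a, k) # x'" "y = (a, l) # y'"
        by (cases x; cases y) auto
      show ?thesis
      proof (cases "k = l")
        case True
        then show ?thesis using xy unfolding eq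
          by (simp add: g_def \<kappa>_def u_def K_def winv_times_cancel power_add algebra_simps)
      next
        case False
        then show ?thesis using xy unfolding eq
          by (simp add: g_def \<kappa>_def u_def K_def wsq_winv_times_same power_add algebra_simps)
      qed
    qed
  qed
  finally show ?case .
qed

lemma psd_on_power_norm2_sq:
  fixes s :: real
  assumes "-1 \<le> s" "s \<le> 1"
  shows "psd_on UNIV (\<lambda>x y. s ^ norm2_sq (fmult (finv x) y))"
proof (rule psd_onI)
  fix n :: nat and x :: "nat \<Rightarrow> fgroup" and c
  \<comment> \<open>Any bound on the lengths of the finitely many words would do. Adding back the
    rank-one term then recovers the full kernel.\<close>
  define N where "N = (\<Sum>j<n. length (Rep_fgroup (x j)))"
  have "psd_on {w. reduced w \<and> length w \<le> N} (\<lambda>x y. (s ^ wsq (winv_times x y) - s ^ wsq x * s ^ wsq y) + s ^ wsq x * s ^ wsq y)"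
    by (intro psd_on_add psd_on_word_power_diff psd_on_rank_one assms)
  then have "0 \<le> (\<Sum>j<n. \<Sum>k<n. c j * c k * ((s ^ wsq (winv_times (Rep_fgroup (x j)) (Rep_fgroup (x k))) -
       s ^ wsq (Rep_fgroup (x j)) * s ^ wsq (Rep_fgroup (x k))) + s ^ wsq (Rep_fgroup (x j)) * s ^ wsq (Rep_fgroup (x k))))"
  proof (rule psd_onD)
    fix j assume "j < n"
    then have "length (Rep_fgroup (x j)) \<le> N"
      unfolding N_def by (intro member_le_sum) auto
    then show "Rep_fgroup (x j) \<in> {w. reduced w \<and> length w \<le> N}"
      using Rep_fgroup[of "x j"] by simp
  qed
  then show "0 \<le> (\<Sum>j<n. \<Sum>k<n. c j * c k * s ^ norm2_sq (fmult (finv (x j)) (x k)))"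
    by (simp add: norm2_sq_eq_wsq Rep_fmult_finv)
qed

lemma norm2_sq_finv_mult_commute:
  "norm2_sq (fmult (finv x) y) = norm2_sq (fmult (finv y) x)"
  using Rep_fgroup[of x] Rep_fgroup[of y]
  by (simp add: norm2_sq_eq_wsq Rep_fmult_finv wsq_winv_times_commute)

text \<open>The real and imaginary parts of the coefficients give two real forms, whose sum is the
  real part; symmetry makes the imaginary part vanish, as the order on the complex numbers
  requires.\<close>

lemma positive_definite_of_real_iff:
  fixes \<phi> :: "fgroup \<Rightarrow> real"
  assumes sym: "\<And>x y. \<phi> (fmult (finv x) y) = \<phi> (fmult (finv y) x)"
  shows "positive_definite (\<lambda>g. complex_of_real (\<phi> g)) \<longleftrightarrow> psd_on UNIV (\<lambda>x y. \<phi> (fmult (finv x) y))"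
proof
  assume pd: "positive_definite (\<lambda>g. complex_of_real (\<phi> g))"
  show "psd_on UNIV (\<lambda>x y. \<phi> (fmult (finv x) y))"
  proof (rule psd_onI)
    fix n :: nat and x c
    have "0 \<le> (\<Sum>j<n. \<Sum>k<n. complex_of_real (c j) * cnj (complex_of_real (c k)) * complex_of_real (\<phi> (fmult (finv (x j)) (x k))))"
      using pd[unfolded positive_definite_def, rule_format, where n=n and c="\<lambda>j. complex_of_real (c j)" and x=x] .
    also have "\<dots> = complex_of_real (\<Sum>j<n. \<Sum>k<n. c j * c k * \<phi> (fmult (finv (x j)) (x k)))"
      by simp
    finally show "0 \<le> (\<Sum>j<n. \<Sum>k<n. c j * c k * \<phi> (fmult (finv (x j)) (x k)))"
      by (simp add: less_eq_complex_def)
  qed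
next
  assume psd: "psd_on UNIV (\<lambda>x y. \<phi> (fmult (finv x) y))"
  show "positive_definite (\<lambda>g. complex_of_real (\<phi> g))"
    unfolding positive_definite_def
  proof (intro allI)
    fix n :: nat and x :: "nat \<Rightarrow> fgroup" and c :: "nat \<Rightarrow> complex"
    define K where "K j k = \<phi> (fmult (finv (x j)) (x k))" for j k
    let ?S = "\<Sum>j<n. \<Sum>k<n. c j * cnj (c k) * complex_of_real (K j k)"
    have "Re ?S = (\<Sum>j<n. \<Sum>k<n. Re (c j) * Re (c k) * K j k) + (\<Sum>j<n. \<Sum>k<n. Im (c j) * Im (c k) * K j k)"
      by (simp add: sum.distrib[symmetric] algebra_simps)
    moreover have "0 \<le> (\<Sum>j<n. \<Sum>k<n. Re (c j) * Re (c k) * K j k)"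
        "0 \<le> (\<Sum>j<n. \<Sum>k<n. Im (c j) * Im (c k) * K j k)"
      unfolding K_def by (intro psd_onD[OF psd]; simp)+
    moreover have "Im ?S = 0"
    proof -
      have "Im ?S = (\<Sum>j<n. \<Sum>k<n. Im (c j) * Re (c k) * K j k) - (\<Sum>j<n. \<Sum>k<n. Im (c k) * Re (c j) * K j k)"
        by (simp add: sum_subtractf[symmetric] algebra_simps)
      also have "(\<Sum>j<n. \<Sum>k<n. Im (c k) * Re (c j) * K j k) = (\<Sum>k<n. \<Sum>j<n. Im (c k) * Re (c j) * K j k)"
        by (rule sum.swap)
      also have "\<dots> = (\<Sum>j<n. \<Sum>k<n. Im (c j) * Re (c k) * K j k)"
        using sym by (simp add: K_def)
      finally show ?thesis by simp
    qed
    ultimately have "0 \<le> ?S" by (simp add: less_eq_complex_def)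
    then show "0 \<le> (\<Sum>j<n. \<Sum>k<n. c j * cnj (c k) * complex_of_real (\<phi> (fmult (finv (x j)) (x k))))"
      by (simp add: K_def)
  qed
qed

section \<open>The Hausdorff moment problem\<close>

lemma abs_prod_diff_le:
  fixes a b :: "nat \<Rightarrow> real"
  assumes "\<And>i. i < m \<Longrightarrow> \<bar>a i\<bar> \<le> 1" "\<And>i. i < m \<Longrightarrow> \<bar>b i\<bar> \<le> 1"
  shows "\<bar>(\<Prod>i<m. a i) - (\<Prod>i<m. b i)\<bar> \<le> (\<Sum>i<m. \<bar>a i - b i\<bar>)"
  using norm_prod_diff[of "{..<m}" a b] assms by simp

text \<open>The ratio of binomials is the product of \<open>(k - i) / (n - i)\<close> over
  \<open>i < m\<close>. All factors have modulus at most one, and each is within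
  \<open>2 * m / n\<close> of \<open>k / n\<close> because \<open>n - i\<close> is at least
  \<open>n / 2\<close>.\<close>

lemma binomial_ratio_approx:
  assumes "2 * m \<le> n" "k \<le> n" "0 < n"
  shows "\<bar>real (k choose m) / real (n choose m) - (real k / real n) ^ m\<bar> \<le> 2 * (real m)\<^sup>2 / real n"
proof -
  have "real (k choose m) / real (n choose m) =
      (\<Prod>i<m. ((real k - real i) / real (m - i)) / ((real n - real i) / real (m - i)))"
    by (simp add: binomial_gbinomial gbinomial_altdef_of_nat prod_dividef atLeast0LessThan)
  also have "\<dots> = (\<Prod>i<m. (real k - real i) / (real n - real i))"
    by (intro prod.cong) auto
  finally have eq: "real (k choose m) / real (n choose m) = (\<Prod>i<m. (real k - real i) / (real n - real i))" .
  have "\<bar>(\<Prod>i<m. (real k - real i) / (real n - real i)) - (\<Prod>i<m. real k / real n)\<bar>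
      \<le> (\<Sum>i<m. \<bar>(real k - real i) / (real n - real i) - real k / real n\<bar>)"
  proof (rule abs_prod_diff_le)
    \<comment> \<open>For \<open>k < i\<close> the quotient is negative;
      \<open>2 * i \<le> n\<close> then bounds its modulus.\<close>
    fix i assume i: "i < m"
    then have "real i * 2 \<le> real n" using assms by linarith
    moreover have "real k \<le> real n" using assms by simp
    ultimately show "\<bar>(real k - real i) / (real n - real i)\<bar> \<le> 1" using i assms
      by (auto simp: abs_le_iff divide_simps)
  qed (use assms in auto)
  also have "\<dots> \<le> (\<Sum>i<m. 2 * real m / real n)"
  proof (rule sum_mono)
    fix i assume "i \<in> {..<m}"
    then have i: "real i \<le> real m" "2 * real m \<le> real n" "real i < real n" "real k \<le> real n" "0 < real n"
      using assms by auto
    have "(real k - real i) / (real n - real i) - real k / real n =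
        - (real i * (real n - real k) / (real n * (real n - real i)))"
      using i by (simp add: field_simps)
    then have "\<bar>(real k - real i) / (real n - real i) - real k / real n\<bar> =
        real i * (real n - real k) / (real n * (real n - real i))"
      using i by simp
    also have "\<dots> \<le> real m * real n / (real n * (real n / 2))"
      using i by (intro frac_le mult_mono mult_pos_pos) auto
    also have "\<dots> = 2 * real m / real n" using i by simp
    finally show "\<bar>(real k - real i) / (real n - real i) - real k / real n\<bar> \<le> 2 * real m / real n" .
  qed
  also have "\<dots> = 2 * (real m)\<^sup>2 / real n" by (simp add: power2_eq_square)
  finally show ?thesis by (simp add: eq)
qed

text \<open>Composing with this retraction onto the unit interval makes polynomials bounded and
  continuous on the whole line, so weak convergence applies without locating the support of the
  limit.\<close>

definition clamp01 :: "real \<Rightarrow> real" where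
  "clamp01 t = max 0 (min 1 t)"

lemma clamp01_bounds: "0 \<le> clamp01 t" "clamp01 t \<le> 1"
  and clamp01_id: "0 \<le> t \<Longrightarrow> t \<le> 1 \<Longrightarrow> clamp01 t = t"
  and isCont_clamp01 [continuous_intros]: "isCont clamp01 t"
proof -
  have "isCont (\<lambda>t. max 0 (min 1 t :: real)) t"
    by (intro continuous_max continuous_min continuous_const continuous_ident)
  then show "isCont clamp01 t" unfolding clamp01_def .
qed (auto simp: clamp01_def)

lemma borel_measurable_clamp01 [measurable]: "clamp01 \<in> borel_measurable borel"
  by (simp add: borel_measurable_continuous_onI continuous_at_imp_continuous_on isCont_clamp01)

locale poly_functional =
  fixes M :: "real poly \<Rightarrow> real"
  assumes add: "M (p + q) = M p + M q"
    and smult: "M (smult c p) = c * M p"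
begin

lemma zero: "M 0 = 0"
  using smult[of 0 0] by simp

lemma sum: "M (\<Sum>i\<in>A. f i) = (\<Sum>i\<in>A. M (f i))"
  by (induction A rule: infinite_finite_induct) (auto simp: zero add)

lemma diff: "M (p - q) = M p - M q"
  using add[of p "smult (- 1) q"] smult[of "- 1" q] by simp

lemma eq_sum_monom: "M p = (\<Sum>i\<le>degree p. coeff p i * M (monom 1 i))"
proof -
  have "M p = M (\<Sum>i\<le>degree p. monom (coeff p i) i)" by (simp add: poly_as_sum_of_monoms)
  also have "\<dots> = (\<Sum>i\<le>degree p. M (smult (coeff p i) (monom 1 i)))"
    by (simp add: sum smult_monom)
  finally show ?thesis by (simp only: smult)
qed

end

text \<open>Hausdorff's condition in polynomial form: the values at
  \<open>x ^ i * (1 - x) ^ j\<close> are the iterated differences of the moment sequence.\<close>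

locale hausdorff_functional = poly_functional +
  assumes one: "M 1 = 1"
    and bernstein_nonneg: "0 \<le> M ([:0, 1:] ^ i * [:1, - 1:] ^ j)"
begin

text \<open>The value at the Bernstein polynomial of degree \<open>n\<close> and index
  \<open>k\<close>, to become the mass at the point \<open>k / n\<close>.\<close>

definition bern :: "nat \<Rightarrow> nat \<Rightarrow> real" where
  "bern n k = real (n choose k) * M ([:0, 1:] ^ k * [:1, - 1:] ^ (n - k))"

lemma bern_nonneg: "0 \<le> bern n k"
  by (simp add: bern_def bernstein_nonneg)

lemma bern_eq_0: "n < k \<Longrightarrow> bern n k = 0"
  by (simp add: bern_def)

text \<open>Multiply \<open>x ^ m\<close> by \<open>(x + (1 - x)) ^ (n - m) = 1\<close>, expand, and
  shift the index by \<open>m\<close>; a binomial identity turns the coefficients into Bernstein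
  weights. The case \<open>m = 0\<close> gives total mass one.\<close>

lemma moment_eq_bern_sum:
  assumes "m \<le> n"
  shows "M ([:0, 1:] ^ m) = (\<Sum>k\<le>n. bern n k * (real (k choose m) / real (n choose m)))"
proof -
  let ?T = "[:0, 1:] :: real poly" and ?U = "[:1, - 1:] :: real poly"
  have TU: "?T + ?U = 1" by simp
  have bin: "real (n - m choose j) = real (n choose (j + m)) * real (j + m choose m) / real (n choose m)"
    if "j \<le> n - m" for j
  proof -
    have "(n choose (j + m)) * (j + m choose m) = (n choose m) * (n - m choose j)"
      using that assms choose_mult[of m "j + m" n] by simp
    then show ?thesis using assms
      by (simp add: nonzero_eq_divide_eq mult.commute flip: of_nat_mult)
  qed
  have "?T ^ m = ?T ^ m * (?T + ?U) ^ (n - m)" by (simp only: TU) simp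
  also have "\<dots> = (\<Sum>j\<le>n - m. smult (real (n - m choose j)) (?T ^ (j + m) * ?U ^ (n - (j + m))))"
    unfolding binomial_ring sum_distrib_left
    by (intro sum.cong) (auto simp: power_add of_nat_poly add.commute mult_ac)
  finally have "M (?T ^ m) = (\<Sum>j\<le>n - m. real (n - m choose j) * M (?T ^ (j + m) * ?U ^ (n - (j + m))))"
    by (simp add: sum smult)
  also have "\<dots> = (\<Sum>j\<le>n - m. bern n (j + m) * (real (j + m choose m) / real (n choose m)))"
    by (intro sum.cong) (auto simp: bern_def bin)
  also have "\<dots> = (\<Sum>k=m..n. bern n k * (real (k choose m) / real (n choose m)))"
    using sum.shift_bounds_cl_nat_ivl[of "\<lambda>k. bern n k * (real (k choose m) / real (n choose m))" 0 m "n - m"] assms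
    by (simp add: atLeast0AtMost)
  also have "\<dots> = (\<Sum>k\<le>n. bern n k * (real (k choose m) / real (n choose m)))"
    by (intro sum.mono_neutral_left) (auto simp: not_le)
  finally show ?thesis .
qed

lemma bern_sum: "(\<Sum>k\<le>n. bern n k) = 1"
  using moment_eq_bern_sum[of 0 n] by (simp add: one)

text \<open>The preceding identity is exact for binomial ratios; replacing them by powers costs
  little because the weights are nonnegative with sum one.\<close>

lemma moment_approx:
  assumes "2 * m \<le> n" "0 < n"
  shows "\<bar>(\<Sum>k\<le>n. bern n k * (real k / real n) ^ m) - M ([:0, 1:] ^ m)\<bar> \<le> 2 * (real m)\<^sup>2 / real n"
proof -
  have "\<bar>(\<Sum>k\<le>n. bern n k * (real k / real n) ^ m) - M ([:0, 1:] ^ m)\<bar> =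
      \<bar>\<Sum>k\<le>n. bern n k * ((real k / real n) ^ m - real (k choose m) / real (n choose m))\<bar>"
    using assms by (simp add: moment_eq_bern_sum[of m n] right_diff_distrib sum_subtractf)
  also have "\<dots> \<le> (\<Sum>k\<le>n. \<bar>bern n k * ((real k / real n) ^ m - real (k choose m) / real (n choose m))\<bar>)"
    by (rule sum_abs)
  also have "\<dots> \<le> (\<Sum>k\<le>n. bern n k * (2 * (real m)\<^sup>2 / real n))"
  proof (rule sum_mono)
    fix k assume "k \<in> {..n}"
    then have "\<bar>(real k / real n) ^ m - real (k choose m) / real (n choose m)\<bar> \<le> 2 * (real m)\<^sup>2 / real n"
      using binomial_ratio_approx[OF assms(1) _ assms(2), of k] by (simp add: abs_minus_commute)
    then show "\<bar>bern n k * ((real k / real n) ^ m - real (k choose m) / real (n choose m))\<bar> \<le>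
        bern n k * (2 * (real m)\<^sup>2 / real n)"
      unfolding abs_mult by (intro mult_mono) (auto simp: bern_nonneg)
  qed
  also have "\<dots> = 2 * (real m)\<^sup>2 / real n"
    by (simp only: sum_distrib_right[symmetric] bern_sum mult_1)
  finally show ?thesis .
qed

section \<open>Discrete approximating measures and their weak limit\<close>

definition bern_pmf :: "nat \<Rightarrow> nat pmf" where
  "bern_pmf n = embed_pmf (bern n)"

lemma pmf_bern_pmf: "pmf (bern_pmf n) k = bern n k"
  unfolding bern_pmf_def
proof (rule pmf_embed_pmf)
  have "(\<integral>\<^sup>+k. ennreal (bern n k) \<partial>count_space UNIV) = (\<Sum>k\<le>n. ennreal (bern n k))"
    by (rule nn_integral_count_space') (auto simp: bern_eq_0 not_le)
  also have "\<dots> = 1" by (simp add: bern_nonneg bern_sum)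
  finally show "(\<integral>\<^sup>+k. ennreal (bern n k) \<partial>count_space UNIV) = 1" .
qed (simp add: bern_nonneg)

lemma set_bern_pmf: "set_pmf (bern_pmf n) \<subseteq> {..n}"
proof
  fix k assume "k \<in> set_pmf (bern_pmf n)"
  then have "bern n k \<noteq> 0" by (simp add: set_pmf_iff pmf_bern_pmf)
  then show "k \<in> {..n}" using bern_eq_0[of n k] by (cases "n < k") auto
qed

definition bern_measure :: "nat \<Rightarrow> real measure" where
  "bern_measure n = distr (measure_pmf (bern_pmf n)) borel (\<lambda>k. real k / real n)"

lemma real_distribution_bern_measure: "real_distribution (bern_measure n)"
  unfolding bern_measure_def
  by (intro prob_space.real_distribution_distr) (auto simp: measure_pmf.prob_space_axioms)

lemma integral_bern_measure:
  fixes h :: "real \<Rightarrow> real"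
  assumes "h \<in> borel_measurable borel"
  shows "(\<integral>t. h t \<partial>bern_measure n) = (\<Sum>k\<le>n. bern n k * h (real k / real n))"
proof -
  have "(\<integral>t. h t \<partial>bern_measure n) = measure_pmf.expectation (bern_pmf n) (\<lambda>k. h (real k / real n))"
    unfolding bern_measure_def using assms by (intro integral_distr) auto
  also have "\<dots> = (\<Sum>k\<le>n. pmf (bern_pmf n) k *\<^sub>R h (real k / real n))"
    by (intro integral_measure_pmf) (use set_bern_pmf in auto)
  finally show ?thesis by (simp add: pmf_bern_pmf)
qed

lemma tight_bern_measure: "tight (\<lambda>n. bern_measure (Suc n))"
  unfolding tight_def
proof (intro conjI allI impI)
  fix \<epsilon> :: real assume e: "0 < \<epsilon>"
  \<comment> \<open>All mass lies on the unit interval; the left endpoint is \<open>-1\<close>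
    because the intervals are open on the left and \<open>0\<close> may be an atom.\<close>
  have "measure (bern_measure (Suc n)) {-1<..1} = 1" for n
  proof -
    have "measure (bern_measure (Suc n)) {-1<..1} =
        measure_pmf.prob (bern_pmf (Suc n)) ((\<lambda>k. real k / real (Suc n)) -` {-1<..1})"
      unfolding bern_measure_def by (subst measure_distr) auto
    also have "\<dots> = 1"
    proof (subst measure_pmf.prob_eq_1)
      show "AE k in measure_pmf (bern_pmf (Suc n)). k \<in> (\<lambda>k. real k / real (Suc n)) -` {-1<..1}"
      proof (rule AE_pmfI)
        fix k assume "k \<in> set_pmf (bern_pmf (Suc n))"
        then have "k \<le> Suc n" using set_bern_pmf by auto
        then have "real k \<le> real (Suc n)" by simp
        then have "real k / real (Suc n) \<le> 1" by simp
        moreover have "-1 < real k / real (Suc n)"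
          by (rule less_le_trans[of _ 0]) auto
        ultimately show "k \<in> (\<lambda>k. real k / real (Suc n)) -` {-1<..1}" by simp
      qed
    qed auto
    finally show ?thesis .
  qed
  then show "\<exists>a b. a < b \<and> (\<forall>n. 1 - \<epsilon> < measure (bern_measure (Suc n)) {a<..b})"
    using e by (intro exI[of _ "-1"] exI[of _ 1]) auto
qed (rule real_distribution_bern_measure)

lemma moment_bern_measure_tendsto:
  "(\<lambda>n. \<integral>t. clamp01 t ^ m \<partial>bern_measure (Suc n)) \<longlonglongrightarrow> M ([:0, 1:] ^ m)"
proof -
  have int: "(\<integral>t. clamp01 t ^ m \<partial>bern_measure (Suc n)) =
      (\<Sum>k\<le>Suc n. bern (Suc n) k * (real k / real (Suc n)) ^ m)" for n
    by (subst integral_bern_measure)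
       (auto simp del: of_nat_Suc sum.atMost_Suc intro!: sum.cong arg_cong2[of _ _ _ _ "(*)"] arg_cong2[of _ _ _ _ "(^)"] clamp01_id)
  have "(\<lambda>n. (\<integral>t. clamp01 t ^ m \<partial>bern_measure (Suc n)) - M ([:0, 1:] ^ m)) \<longlonglongrightarrow> 0"
  proof (rule Lim_null_comparison)
    show "\<forall>\<^sub>F n in sequentially. norm ((\<integral>t. clamp01 t ^ m \<partial>bern_measure (Suc n)) - M ([:0, 1:] ^ m))
        \<le> 2 * (real m)\<^sup>2 / real (Suc n)"
      using eventually_ge_at_top[of "2 * m"]
      by eventually_elim (use moment_approx[of m] in \<open>simp only: int real_norm_def; simp del: of_nat_Suc sum.atMost_Suc\<close>)
    show "(\<lambda>n. 2 * (real m)\<^sup>2 / real (Suc n)) \<longlonglongrightarrow> 0"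
      by (rule LIMSEQ_Suc[OF lim_const_over_n])
  qed
  then show ?thesis by (simp add: LIM_zero_iff)
qed

text \<open>Tightness yields a weakly convergent subsequence (Helly). The powers of
  \<open>clamp01\<close> are bounded and continuous, so the moments pass to the limit, and linearity
  extends the formula to all polynomials.\<close>

theorem representing_measure:
  "\<exists>\<nu>. real_distribution \<nu> \<and> (\<forall>p. M p = (\<integral>t. poly p (clamp01 t) \<partial>\<nu>))"
proof -
  obtain r \<nu> where r: "strict_mono (r :: nat \<Rightarrow> nat)" and nu: "real_distribution \<nu>"
    and conv: "weak_conv_m ((\<lambda>n. bern_measure (Suc n)) \<circ> id \<circ> r) \<nu>"
    using tight_imp_convergent_subsubsequence[OF tight_bern_measure strict_mono_id] by blast
  interpret nu: real_distribution \<nu> by fact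
  have mom: "(\<integral>t. clamp01 t ^ m \<partial>\<nu>) = M ([:0, 1:] ^ m)" for m
  proof (rule LIMSEQ_unique)
    show "(\<lambda>n. \<integral>t. clamp01 t ^ m \<partial>((\<lambda>n. bern_measure (Suc n)) \<circ> id \<circ> r) n) \<longlonglongrightarrow> (\<integral>t. clamp01 t ^ m \<partial>\<nu>)"
    proof (rule weak_conv_imp_integral_bdd_continuous_conv[OF _ nu conv])
      show "norm (clamp01 x ^ m) \<le> 1" for x
        using clamp01_bounds[of x] by (simp add: power_le_one)
    qed (auto intro!: continuous_intros real_distribution_bern_measure)
    show "(\<lambda>n. \<integral>t. clamp01 t ^ m \<partial>((\<lambda>n. bern_measure (Suc n)) \<circ> id \<circ> r) n) \<longlonglongrightarrow> M ([:0, 1:] ^ m)"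
      using LIMSEQ_subseq_LIMSEQ[OF moment_bern_measure_tendsto r] by (simp add: comp_def)
  qed
  have int: "integrable \<nu> (\<lambda>t. clamp01 t ^ m)" for m
    by (rule nu.integrable_const_bound[where B=1])
       (use clamp01_bounds in \<open>auto simp: power_le_one\<close>)
  have "M p = (\<integral>t. poly p (clamp01 t) \<partial>\<nu>)" for p
  proof -
    have "M p = (\<Sum>i\<le>degree p. coeff p i * (\<integral>t. clamp01 t ^ i \<partial>\<nu>))"
      by (subst eq_sum_monom) (simp add: mom monom_altdef)
    also have "\<dots> = (\<integral>t. poly p (clamp01 t) \<partial>\<nu>)"
      by (simp add: poly_altdef int)
    finally show ?thesis .
  qed
  with nu show ?thesis by blast
qed

end

section \<open>Bounded Hankel sequences\<close>

definition moment_functional :: "(nat \<Rightarrow> real) \<Rightarrow> real poly \<Rightarrow> real" where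
  "moment_functional f p = (\<Sum>i\<le>degree p. coeff p i * f i)"

text \<open>Summing up to a common bound beyond all degrees lets linearity be checked
  termwise.\<close>

lemma moment_functional_altdef:
  assumes "degree p < n"
  shows "moment_functional f p = (\<Sum>i<n. coeff p i * f i)"
  unfolding moment_functional_def
  using assms by (intro sum.mono_neutral_left) (auto simp: coeff_eq_0)

lemma moment_functional_monom: "moment_functional f (monom 1 n) = f n"
proof -
  have "moment_functional f (monom 1 n) = (\<Sum>i<Suc n. coeff (monom 1 n) i * f i)"
    by (rule moment_functional_altdef) (simp add: degree_monom_eq)
  also have "\<dots> = f n" by (simp add: coeff_monom sum.delta)
  finally show ?thesis .
qed

lemma poly_functional_moment: "poly_functional (moment_functional f)"
proof
  fix p q :: "real poly" and c :: real
  define n where "n = Suc (max (degree p) (degree q))"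
  have n: "degree p < n" "degree q < n" "degree (p + q) < n" "degree (smult c p) < n"
    using degree_add_le_max[of p q] degree_smult_le[of c p] by (auto simp: n_def less_Suc_eq_le)
  show "moment_functional f (p + q) = moment_functional f p + moment_functional f q"
    by (simp add: moment_functional_altdef[OF n(1)] moment_functional_altdef[OF n(2)]
        moment_functional_altdef[OF n(3)] distrib_right sum.distrib)
  show "moment_functional f (smult c p) = c * moment_functional f p"
    by (simp add: moment_functional_altdef[OF n(1)] moment_functional_altdef[OF n(4)] sum_distrib_left mult.assoc)
qed

lemma pcompose_power: "pcompose (p ^ n) q = pcompose p q ^ n" for p q :: "'a :: comm_semiring_1 poly"
  by (induction n) (simp_all add: pcompose_1 pcompose_mult)

locale bounded_hankel =
  fixes f :: "nat \<Rightarrow> real"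
  assumes hankel_psd: "psd_on UNIV (\<lambda>m n. f (m + n))"
    and bounded: "\<bar>f n\<bar> \<le> 1"
    and f_0: "f 0 = 1"
begin

abbreviation L :: "real poly \<Rightarrow> real" where "L \<equiv> moment_functional f"

sublocale poly_functional L by (rule poly_functional_moment)

text \<open>Expanding the product gives the Hankel form of \<open>f\<close> at the coefficients of
  \<open>p\<close>.\<close>

lemma square_nonneg: "0 \<le> L (p * p)"
proof -
  define n where "n = Suc (degree p)"
  have p: "p = (\<Sum>i<n. monom (coeff p i) i)"
    by (simp add: n_def lessThan_Suc_atMost poly_as_sum_of_monoms)
  have "p * p = (\<Sum>i<n. \<Sum>j<n. smult (coeff p i * coeff p j) (monom 1 (i + j)))"
    by (subst (1 2) p) (simp add: sum_product mult_monom smult_monom)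
  then have "L (p * p) = (\<Sum>i<n. \<Sum>j<n. coeff p i * coeff p j * f (i + j))"
    by (simp only: sum smult moment_functional_monom)
  also have "\<dots> \<ge> 0"
    by (rule psd_onD[OF hankel_psd]) simp
  finally show ?thesis .
qed

text \<open>The uniformity in \<open>n\<close> rules out linear growth of the sequence in
  \<open>one_minus_x2_nonneg\<close>.\<close>

lemma L_monom_mult_bounded: "\<bar>L (monom 1 n * q)\<bar> \<le> (\<Sum>i\<le>degree q. \<bar>coeff q i\<bar>)"
proof -
  have "monom 1 n * q = (\<Sum>i\<le>degree q. smult (coeff q i) (monom 1 (n + i)))"
    by (subst poly_as_sum_of_monoms[of q, symmetric])
       (simp add: sum_distrib_left mult_monom smult_monom del: poly_as_sum_of_monoms)
  then have "L (monom 1 n * q) = (\<Sum>i\<le>degree q. coeff q i * f (n + i))"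
    by (simp only: sum smult moment_functional_monom)
  also have "\<bar>\<dots>\<bar> \<le> (\<Sum>i\<le>degree q. \<bar>coeff q i * f (n + i)\<bar>)" by (rule sum_abs)
  also have "\<dots> \<le> (\<Sum>i\<le>degree q. \<bar>coeff q i\<bar>)"
    by (intro sum_mono) (simp add: abs_mult bounded mult_left_le)
  finally show ?thesis .
qed

text \<open>The sequence \<open>n \<mapsto> L (x\<^sup>2\<^sup>n q)\<close> with \<open>q = p\<^sup>2\<close> is convex and bounded, hence its first step is
  not an increase.\<close>

lemma one_minus_x2_nonneg: "0 \<le> L ([:1, 0, - 1:] * (p * p))"
proof (rule ccontr)
  define a where "a n = L (monom 1 (2 * n) * (p * p))" for n
  define d where "d = a 1 - a 0"
  assume "\<not> ?thesis"
  moreover have "[:1, 0, - 1:] * (p * p) = monom 1 (2 * 0) * (p * p) - monom 1 (2 * 1) * (p * p)"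
    by (simp add: monom_altdef numeral_2_eq_2 algebra_simps)
  ultimately have d: "d > 0" by (simp add: d_def a_def diff del: mult_zero_right mult_1_right)
  have convex: "a (Suc n) - a n \<le> a (Suc (Suc n)) - a (Suc n)" for n
  proof -
    \<comment> \<open>The value of \<open>L\<close> at the square of
      \<open>x ^ n * (1 - x ^ 2) * p\<close> is the second difference of \<open>a\<close> at
      \<open>n\<close>.\<close>
    let ?q = "monom 1 n * [:1, 0, - 1:] * p"
    have sq: "[:1, 0, - 1 :: real:] = 1 - monom 1 2"
      by (simp add: monom_altdef numeral_2_eq_2 one_pCons)
    have square: "A * (1 - B) * p * (A * (1 - B) * p) =
        A * A * (p * p) - A * A * B * (p * p) - (A * A * B * (p * p) - A * A * B * B * (p * p))" for A B
      by (simp add: algebra_simps)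
    have monoms: "monom 1 n * monom 1 n = monom (1 :: real) (2 * n)"
        "monom 1 (2 * m) * monom 1 2 = monom (1 :: real) (2 * Suc m)" for m
      by (simp_all add: mult_monom mult_2)
    have "L (?q * ?q) = a n - a (Suc n) - (a (Suc n) - a (Suc (Suc n)))"
      by (simp only: sq square monoms a_def diff)
    with square_nonneg[of ?q] show ?thesis by linarith
  qed
  have step: "d \<le> a (Suc n) - a n" for n
  proof (induction n)
    case (Suc n)
    then show ?case using convex[of n] by linarith
  qed (simp add: d_def)
  have grow: "a 0 + real n * d \<le> a n" for n
  proof (induction n)
    case (Suc n)
    then show ?case using step[of n] by (simp add: distrib_right)
  qed simp
  define C where "C = (\<Sum>i\<le>degree (p * p). \<bar>coeff (p * p) i\<bar>)"
  have "a n \<le> C" for n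
    using L_monom_mult_bounded[of "2 * n" "p * p"] by (simp add: a_def C_def)
  moreover obtain n :: nat where "(C - a 0) / d < real n"
    using reals_Archimedean2 by blast
  ultimately show False
    using grow[of n] d by (smt (verit) pos_divide_less_eq)
qed

text \<open>Since \<open>e * e = 1\<close>,
  \<open>2 * (1 + e * x) = (1 + e * x) ^ 2 + (1 - x ^ 2)\<close>.\<close>

lemma one_pm_x_nonneg:
  assumes "e = 1 \<or> e = - 1"
  shows "0 \<le> L ([:1, e:] * (p * p))"
proof -
  let ?q = "[:1, e:] * p"
  have ee: "e * e = 1" using assms by auto
  have "?q * ?q + [:1, 0, - 1:] * (p * p) = smult 2 ([:1, e:] * (p * p))"
  proof -
    have "[:1, e:] * [:1, e:] + [:1, 0, - 1:] = smult 2 [:1, e:]" using ee by simp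
    then have "([:1, e:] * [:1, e:] + [:1, 0, - 1:]) * (p * p) = smult 2 [:1, e:] * (p * p)" by simp
    moreover have "([:1, e:] * [:1, e:] + [:1, 0, - 1:]) * (p * p) = ?q * ?q + [:1, 0, - 1:] * (p * p)"
      by (simp only: ring_distribs mult_ac)
    ultimately show ?thesis by (simp only: mult_smult_left)
  qed
  then have "2 * L ([:1, e:] * (p * p)) = L (?q * ?q) + L ([:1, 0, - 1:] * (p * p))"
    by (metis add smult)
  then show ?thesis using square_nonneg[of ?q] one_minus_x2_nonneg[of p] by linarith
qed

text \<open>Pairing equal factors leaves a square \<open>?p * ?p\<close> times one of
  \<open>1\<close>, \<open>1 + x\<close>, \<open>1 - x\<close> and \<open>1 - x ^ 2\<close>, all
  settled above.\<close>

lemma bernstein_pm1_nonneg: "0 \<le> L ([:1, 1:] ^ i * [:1, - 1:] ^ j)"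
proof -
  let ?T = "[:1, 1:] :: real poly" and ?U = "[:1, - 1:] :: real poly"
  let ?p = "?T ^ (i div 2) * ?U ^ (j div 2)"
  have pow: "q ^ n = q ^ (n mod 2) * (q ^ (n div 2) * q ^ (n div 2))" for q :: "real poly" and n
    by (metis mod_mult_div_eq mult_2 power_add)
  have "?T ^ i * ?U ^ j = (?T ^ (i mod 2) * ?U ^ (j mod 2)) * (?p * ?p)"
    by (subst pow[of ?T i], subst pow[of ?U j]) (simp only: mult_ac)
  moreover have "?T * ?U = [:1, 0, - 1:]" by simp
  moreover have "i mod 2 = 0 \<or> i mod 2 = 1" "j mod 2 = 0 \<or> j mod 2 = 1" by auto
  ultimately show ?thesis
    using square_nonneg[of ?p] one_minus_x2_nonneg[of ?p] one_pm_x_nonneg[of 1 ?p] one_pm_x_nonneg[of "-1" ?p]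
    by (elim disjE) (simp_all only: power_0 power_one_right mult_1 mult_1_right simp_thms)
qed

theorem representing_measure:
  "\<exists>\<mu> :: real measure. prob_space \<mu> \<and> sets \<mu> = sets (restrict_space borel {-1..1}) \<and>
     (\<forall>n. f n = (\<integral>s. s ^ n \<partial>\<mu>))"
proof -
  \<comment> \<open>The substitution \<open>t = (1 + x) / 2\<close> moves the problem from
    \<open>[-1, 1]\<close> to the unit interval: \<open>t\<close> and \<open>1 - t\<close> become
    half of \<open>1 + x\<close> and half of \<open>1 - x\<close>.\<close>
  define M where "M p = L (pcompose p [:1/2, 1/2:])" for p
  interpret M: hausdorff_functional M
  proof
    show "M (p + q) = M p + M q" for p q by (simp add: M_def pcompose_add add)
    show "M (smult c p) = c * M p" for c p by (simp add: M_def pcompose_smult smult)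
    show "M 1 = 1" using moment_functional_monom[of f 0] by (simp add: M_def f_0 pcompose_1)
    show "0 \<le> M ([:0, 1:] ^ i * [:1, - 1:] ^ j)" for i j
    proof -
      have half: "[:1/2, 1/2 :: real:] = smult (1/2) [:1, 1:]" "[:1/2, - 1/2 :: real:] = smult (1/2) [:1, - 1:]"
        by simp_all
      have "pcompose ([:0, 1:] ^ i * [:1, - 1:] ^ j) [:1/2, 1/2:] = [:1/2, 1/2:] ^ i * [:1/2, - 1/2 :: real:] ^ j"
        by (simp add: pcompose_mult pcompose_power pcompose_pCons)
      also have "\<dots> = smult ((1/2) ^ j * (1/2) ^ i) ([:1, 1:] ^ i * [:1, - 1:] ^ j)"
        by (simp only: half smult_power mult_smult_left mult_smult_right smult_smult)
      finally show ?thesis unfolding M_def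
        by (simp only: smult) (intro mult_nonneg_nonneg bernstein_pm1_nonneg, simp_all)
    qed
  qed
  obtain \<nu> where nu: "real_distribution \<nu>" and M: "\<And>p. M p = (\<integral>t. poly p (clamp01 t) \<partial>\<nu>)"
    using M.representing_measure by blast
  interpret nu: real_distribution \<nu> by fact
  define \<mu> where "\<mu> = distr \<nu> (restrict_space borel {-1..1}) (\<lambda>t. 2 * clamp01 t - 1)"
  have meas: "(\<lambda>t. 2 * clamp01 t - 1) \<in> \<nu> \<rightarrow>\<^sub>M restrict_space borel {-1..1}"
  proof (rule measurable_restrict_space2)
    show "(\<lambda>t. 2 * clamp01 t - 1) \<in> space \<nu> \<rightarrow> {-1..1}"
      using clamp01_bounds by (auto simp: algebra_simps)
  qed simp
  have "f n = (\<integral>s. s ^ n \<partial>\<mu>)" for n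
  proof -
    have "(\<integral>s. s ^ n \<partial>\<mu>) = (\<integral>t. (2 * clamp01 t - 1) ^ n \<partial>\<nu>)"
      unfolding \<mu>_def by (rule integral_distr[OF meas]) (simp add: measurable_restrict_space1)
    also have "\<dots> = M ([:-1, 2:] ^ n)"
      by (simp add: M algebra_simps)
    \<comment> \<open>\<open>2 * t - 1\<close> inverts the substitution, so the composition gives
      back \<open>x ^ n\<close>.\<close>
    also have "\<dots> = L (monom 1 n)"
      by (simp add: M_def pcompose_power pcompose_pCons monom_altdef)
    finally show ?thesis by (simp add: moment_functional_monom)
  qed
  moreover have "prob_space \<mu>" unfolding \<mu>_def by (rule nu.prob_space_distr[OF meas])
  ultimately show ?thesis by (intro exI[of _ \<mu>]) (simp add: \<mu>_def)
qed

end

section \<open>Uniqueness of a measure on [-1, 1] with given moments\<close>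

lemma measure_on_pm1:
  fixes M :: "real measure"
  assumes "prob_space M" "sets M = sets (restrict_space borel {-1..1})"
  shows space_pm1: "space M = {-1..1}"
    and measurable_ident_pm1: "(\<lambda>x. x) \<in> M \<rightarrow>\<^sub>M borel"
    and integrable_power_pm1: "integrable M (\<lambda>s. s ^ n)"
proof -
  interpret prob_space M by fact
  show sp: "space M = {-1..1}"
    using sets_eq_imp_space_eq[OF assms(2)] by (simp add: space_restrict_space)
  show [measurable]: "(\<lambda>x. x) \<in> M \<rightarrow>\<^sub>M borel"
    using measurable_restrict_space1[of "\<lambda>x. x" borel borel "{-1..1}"]
    by (simp add: measurable_cong_sets[OF assms(2) refl])
  show "integrable M (\<lambda>s. s ^ n)"
    by (rule integrable_const_bound[where B=1])
       (auto simp: sp power_abs intro!: AE_I2 power_le_one)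
qed

text \<open>For \<open>\<bar>s\<bar> \<le> 1\<close> the series of \<open>exp (\<i> * t * s)\<close>
  is dominated by that of \<open>exp \<bar>t\<bar>\<close>, so it may be integrated termwise. Thus
  the moments determine the characteristic function, which determines the measure (Levy).\<close>

lemma moments_unique_on_pm1:
  fixes \<mu> \<nu> :: "real measure"
  assumes "prob_space \<mu>" "sets \<mu> = sets (restrict_space borel {-1..1})"
    and "prob_space \<nu>" "sets \<nu> = sets (restrict_space borel {-1..1})"
    and moments: "\<And>n. (\<integral>s. s ^ n \<partial>\<mu>) = (\<integral>s. s ^ n \<partial>\<nu>)"
  shows "\<mu> = \<nu>"
proof -
  let ?I = "{-1..1 :: real}"
  \<comment> \<open>The measures are pushed to the whole line, where Levy's theorem applies, and
    recovered by restriction.\<close>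
  have key: "real_distribution (distr M borel (\<lambda>x. x))"
      "(\<lambda>n. (\<i> * t) ^ n /\<^sub>R fact n * complex_of_real (\<integral>s. s ^ n \<partial>M)) sums char (distr M borel (\<lambda>x. x)) t"
      "restrict_space (distr M borel (\<lambda>x. x)) ?I = M"
    if M: "prob_space M" "sets M = sets (restrict_space borel ?I)" for M :: "real measure" and t :: real
  proof -
    interpret prob_space M by fact
    note sp = space_pm1[OF M] and ints = integrable_power_pm1[OF M]
    note [measurable] = measurable_ident_pm1[OF M]
    show "real_distribution (distr M borel (\<lambda>x. x))"
      by (rule real_distribution_distr) measurable
    have term_eq: "(\<i> * t) ^ n /\<^sub>R fact n * complex_of_real (s ^ n) = (\<i> * (t * s)) ^ n /\<^sub>R fact n" for n s
      by (simp add: power_mult_distrib)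
    have bound: "norm ((\<i> * t) ^ n /\<^sub>R fact n * complex_of_real (s ^ n)) \<le> \<bar>t\<bar> ^ n /\<^sub>R fact n" if "s \<in> ?I" for n s
      using that by (auto simp: norm_mult norm_power power_abs abs_le_iff intro!: mult_left_le power_le_one divide_nonneg_pos)
    have summ: "summable (\<lambda>n. \<bar>t\<bar> ^ n /\<^sub>R fact n)" by (rule summable_exp_generic)
    have "(\<lambda>n. \<integral>s. (\<i> * t) ^ n /\<^sub>R fact n * complex_of_real (s ^ n) \<partial>M) sums
          (\<integral>s. (\<Sum>n. (\<i> * t) ^ n /\<^sub>R fact n * complex_of_real (s ^ n)) \<partial>M)"
    proof (rule sums_integral)
      show int: "integrable M (\<lambda>s. (\<i> * t) ^ n /\<^sub>R fact n * complex_of_real (s ^ n))" for n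
        by (intro integrable_mult_right integrable_of_real ints)
      show "AE s in M. summable (\<lambda>n. norm ((\<i> * t) ^ n /\<^sub>R fact n * complex_of_real (s ^ n)))"
        using bound by (intro AE_I2 summable_comparison_test'[OF summ, of 0]) (auto simp: sp)
      show "summable (\<lambda>n. \<integral>s. norm ((\<i> * t) ^ n /\<^sub>R fact n * complex_of_real (s ^ n)) \<partial>M)"
      proof (rule summable_comparison_test'[OF summ, of 0])
        fix n
        have "norm (\<integral>s. norm ((\<i> * t) ^ n /\<^sub>R fact n * complex_of_real (s ^ n)) \<partial>M) =
            (\<integral>s. norm ((\<i> * t) ^ n /\<^sub>R fact n * complex_of_real (s ^ n)) \<partial>M)"
          unfolding real_norm_def by (intro abs_of_nonneg integral_nonneg) auto
        also have "\<dots> \<le> (\<integral>s. \<bar>t\<bar> ^ n /\<^sub>R fact n \<partial>M)"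
          using bound sp by (intro integral_mono integrable_norm int) auto
        finally show "norm (\<integral>s. norm ((\<i> * t) ^ n /\<^sub>R fact n * complex_of_real (s ^ n)) \<partial>M) \<le> \<bar>t\<bar> ^ n /\<^sub>R fact n"
          by (simp add: prob_space)
      qed
    qed
    also have "(\<lambda>n. \<integral>s. (\<i> * t) ^ n /\<^sub>R fact n * complex_of_real (s ^ n) \<partial>M) =
        (\<lambda>n. (\<i> * t) ^ n /\<^sub>R fact n * complex_of_real (\<integral>s. s ^ n \<partial>M))"
      by (simp only: integral_mult_right_zero integral_complex_of_real)
    also have "(\<integral>s. (\<Sum>n. (\<i> * t) ^ n /\<^sub>R fact n * complex_of_real (s ^ n)) \<partial>M) = (\<integral>s. iexp (t * s) \<partial>M)"
      unfolding term_eq by (simp add: exp_def)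
    also have "\<dots> = char (distr M borel (\<lambda>x. x)) t"
      unfolding char_def by (subst integral_distr) auto
    finally show "(\<lambda>n. (\<i> * t) ^ n /\<^sub>R fact n * complex_of_real (\<integral>s. s ^ n \<partial>M)) sums char (distr M borel (\<lambda>x. x)) t" .
    show "restrict_space (distr M borel (\<lambda>x. x)) ?I = M"
    proof (rule measure_eqI)
      show "sets (restrict_space (distr M borel (\<lambda>x. x)) ?I) = sets M"
        unfolding M(2) by (rule sets_restrict_space_cong) simp
      fix A assume "A \<in> sets (restrict_space (distr M borel (\<lambda>x. x)) ?I)"
      then have A: "A \<in> sets borel" "A \<subseteq> ?I"
        by (auto simp: sets_restrict_space_iff)
      have "emeasure (restrict_space (distr M borel (\<lambda>x. x)) ?I) A = emeasure (distr M borel (\<lambda>x. x)) A"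
        using A by (intro emeasure_restrict_space) auto
      also have "\<dots> = emeasure M A"
        using A by (subst emeasure_distr) (auto simp: sp Int_absorb2)
      finally show "emeasure (restrict_space (distr M borel (\<lambda>x. x)) ?I) A = emeasure M A" .
    qed
  qed
  have "char (distr \<mu> borel (\<lambda>x. x)) t = char (distr \<nu> borel (\<lambda>x. x)) t" for t
    using key(2)[OF assms(1,2), of t] key(2)[OF assms(3,4), of t] unfolding moments by (rule sums_unique2)
  then have "distr \<mu> borel (\<lambda>x. x) = distr \<nu> borel (\<lambda>x. x)"
    by (intro Levy_uniqueness key(1) assms) auto
  then show ?thesis using key(3)[OF assms(1,2)] key(3)[OF assms(3,4)] by metis
qed

section \<open>Radial functions on the free group\<close>

text \<open>\<open>prod_encode\<close> divides the generators into infinitely many infinite blocks,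
  so words with different \<open>i\<close> share no generator. Exponents \<open>1\<close> make every
  natural number a squared norm.\<close>

definition fresh_word :: "nat \<Rightarrow> nat \<Rightarrow> (nat \<times> int) list" where
  "fresh_word i m = map (\<lambda>j. (prod_encode (i, j), 1)) [0..<m]"

lemma reduced_if_distinct_generators:
  "distinct (map fst w) \<Longrightarrow> (\<forall>p\<in>set w. snd p \<noteq> 0) \<Longrightarrow> reduced w"
  by (induction w rule: reduced.induct) auto

lemma reduced_fresh_word: "reduced (fresh_word i m)"
  by (rule reduced_if_distinct_generators) (auto simp: fresh_word_def distinct_map inj_on_def comp_def)

lemma wsq_fresh_word: "wsq (fresh_word i m) = m"
  by (induction m) (auto simp: fresh_word_def wsq_def)

lemma wsq_winv_times_fresh_words:
  assumes "i \<noteq> j"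
  shows "wsq (winv_times (fresh_word i m) (fresh_word j n)) = m + n"
proof -
  have hd: "hd (fresh_word i m) = (prod_encode (i, 0), 1)" if "fresh_word i m \<noteq> []" for i m
    using that by (auto simp: fresh_word_def hd_map upt_rec)
  have "wsq (winv_times (fresh_word i m) (fresh_word j n)) = wsq (fresh_word i m) + wsq (fresh_word j n)"
    using assms by (intro wsq_winv_times_no_cancel reduced_fresh_word) (auto simp: hd)
  then show ?thesis by (simp add: wsq_fresh_word)
qed

lemma sum_mod_blocks:
  fixes g :: "nat \<Rightarrow> real"
  shows "(\<Sum>i<N * n. g (i mod n)) = real N * (\<Sum>j<n. g j)"
proof (induction N)
  case (Suc N)
  have "(\<Sum>i<Suc N * n. g (i mod n)) = (\<Sum>i<N * n. g (i mod n)) + (\<Sum>i<n. g ((N * n + i) mod n))"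
    using sum.nat_group[of "\<lambda>i. g (i mod n)" n "Suc N"] sum.nat_group[of "\<lambda>i. g (i mod n)" n N]
      sum.shift_bounds_nat_ivl[of "\<lambda>i. g (i mod n)" 0 "N * n" n]
    by (simp add: lessThan_atLeast0 add.commute)
  also have "(\<Sum>i<n. g ((N * n + i) mod n)) = (\<Sum>i<n. g i)"
    by (intro sum.cong) auto
  finally show ?case using Suc by (simp add: distrib_right)
qed simp

lemma nonneg_if_quadratic_growth:
  fixes S C :: real
  assumes "\<And>N::nat. 0 \<le> (real N)\<^sup>2 * S + real N * C"
  shows "0 \<le> S"
proof (rule ccontr)
  assume "\<not> 0 \<le> S"
  then have S: "S < 0" by simp
  obtain N :: nat where N: "max 1 (C / (- S)) < real N" using reals_Archimedean2 by blast
  then have "C / (- S) < real N" "0 < real N" by linarith+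
  then have "C < real N * (- S)" using S pos_divide_less_eq[of "- S" C "real N"] by linarith
  with \<open>0 < real N\<close> have "real N * (real N * S + C) < 0" by (intro mult_pos_neg) auto
  with assms[of N] show False by (simp add: power2_eq_square algebra_simps)
qed

text \<open>Each coefficient is spread over \<open>N\<close> words on pairwise disjoint sets of generators; then
  \<open>\<parallel>x\<^sup>-\<^sup>1y\<parallel>\<^sup>2 = \<parallel>x\<parallel>\<^sup>2 + \<parallel>y\<parallel>\<^sup>2\<close> off the diagonal, and the diagonal contributes only a
  fraction \<open>1/N\<close>.\<close>

lemma hankel_psd_if_radial_psd:
  fixes f :: "nat \<Rightarrow> real"
  assumes "psd_on UNIV (\<lambda>x y. f (norm2_sq (fmult (finv x) y)))"
  shows "psd_on UNIV (\<lambda>m n. f (m + n))"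
proof (rule psd_onI)
  fix n :: nat and x :: "nat \<Rightarrow> nat" and c :: "nat \<Rightarrow> real"
  define S where "S = (\<Sum>j<n. \<Sum>k<n. c j * c k * f (x j + x k))"
  \<comment> \<open>Diagonal correction: the identity has squared norm \<open>0\<close>, so a
    diagonal term carries \<open>f 0\<close> instead of \<open>f (x j + x j)\<close>. Its total
    grows linearly in \<open>N\<close>, the main part quadratically.\<close>
  define C where "C = (\<Sum>j<n. (c j)\<^sup>2 * (f 0 - f (x j + x j)))"
  show "0 \<le> S"
  proof (rule nonneg_if_quadratic_growth)
    fix N :: nat
    define w where "w i = Abs_fgroup (fresh_word i (x (i mod n)))" for i
    define F where "F j k = c j * c k * f (x j + x k)" for j k
    have Rep_w: "Rep_fgroup (w i) = fresh_word i (x (i mod n))" for i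
      unfolding w_def by (rule Abs_fgroup_inverse) (simp add: reduced_fresh_word)
    have norm_w: "norm2_sq (fmult (finv (w i)) (w j)) = (if i = j then 0 else x (i mod n) + x (j mod n))" for i j
      by (simp add: norm2_sq_eq_wsq Rep_fmult_finv Rep_w winv_times_self reduced_fresh_word
          wsq_winv_times_fresh_words)
    have "0 \<le> (\<Sum>i<N * n. \<Sum>j<N * n. c (i mod n) * c (j mod n) * f (norm2_sq (fmult (finv (w i)) (w j))))"
      by (rule psd_onD[OF assms, where c="\<lambda>i. c (i mod n)" and x=w]) simp
    also have "\<dots> = (\<Sum>i<N * n. \<Sum>j<N * n. F (i mod n) (j mod n) +
        (if j = i then (c (i mod n))\<^sup>2 * (f 0 - f (x (i mod n) + x (i mod n))) else 0))"
      by (intro sum.cong refl) (auto simp: norm_w F_def power2_eq_square algebra_simps)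
    also have "\<dots> = (\<Sum>i<N * n. \<Sum>j<N * n. F (i mod n) (j mod n)) +
        (\<Sum>i<N * n. (c (i mod n))\<^sup>2 * (f 0 - f (x (i mod n) + x (i mod n))))"
      by (simp add: sum.distrib)
    also have "(\<Sum>i<N * n. (c (i mod n))\<^sup>2 * (f 0 - f (x (i mod n) + x (i mod n)))) = real N * C"
      unfolding C_def by (rule sum_mod_blocks)
    also have "(\<Sum>i<N * n. \<Sum>j<N * n. F (i mod n) (j mod n)) = (\<Sum>i<N * n. real N * (\<Sum>j<n. F (i mod n) j))"
      by (intro sum.cong refl sum_mod_blocks)
    also have "\<dots> = real N * (\<Sum>i<n. real N * (\<Sum>j<n. F i j))"
      by (rule sum_mod_blocks)
    also have "\<dots> = (real N)\<^sup>2 * S"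
      by (simp add: S_def F_def power2_eq_square sum_distrib_left mult.assoc)
    finally show "0 \<le> (real N)\<^sup>2 * S + real N * C" .
  qed
qed

text \<open>Testing on the identity \<open>w 0\<close> and a word \<open>w 1\<close> of squared norm
  \<open>m\<close> with coefficients \<open>(1, 1)\<close> and \<open>(1, -1)\<close> shows that
  \<open>2 + 2 * f m\<close> and \<open>2 - 2 * f m\<close> are nonnegative.\<close>

lemma bounded_if_radial_psd:
  fixes f :: "nat \<Rightarrow> real"
  assumes "psd_on UNIV (\<lambda>x y. f (norm2_sq (fmult (finv x) y)))" "f 0 = 1"
  shows "\<bar>f m\<bar> \<le> 1"
proof -
  define w where "w i = Abs_fgroup (fresh_word i (if i = 0 then 0 else m))" for i
  have Rep_w: "Rep_fgroup (w i) = fresh_word i (if i = 0 then 0 else m)" for i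
    unfolding w_def by (rule Abs_fgroup_inverse) (simp add: reduced_fresh_word)
  have norm_w: "norm2_sq (fmult (finv (w i)) (w j)) =
      (if i = j then 0 else (if i = 0 then 0 else m) + (if j = 0 then 0 else m))" for i j
    unfolding norm2_sq_eq_wsq Rep_fmult_finv Rep_w
    by (cases "i = j") (simp_all add: winv_times_self reduced_fresh_word wsq_winv_times_fresh_words)
  have "0 \<le> (\<Sum>i<2. \<Sum>j<2. c i * c j * f (norm2_sq (fmult (finv (w i)) (w j))))" for c
    by (rule psd_onD[OF assms(1)]) simp
  from this[of "\<lambda>i. 1"] this[of "\<lambda>i. if i = 0 then 1 else - 1"] show ?thesis
    by (simp add: norm_w numeral_2_eq_2 assms(2))
qed

text \<open>The form is the integral over \<open>s\<close> of the forms of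
  \<open>psd_on_power_norm2_sq\<close>.\<close>

lemma psd_radial_moments:
  fixes \<mu> :: "real measure"
  assumes "prob_space \<mu>" "sets \<mu> = sets (restrict_space borel {-1..1})"
  shows "psd_on UNIV (\<lambda>x y. \<integral>s. s ^ norm2_sq (fmult (finv x) y) \<partial>\<mu>)"
proof (rule psd_onI)
  interpret prob_space \<mu> by fact
  fix n :: nat and x :: "nat \<Rightarrow> fgroup" and c :: "nat \<Rightarrow> real"
  have "(\<Sum>j<n. \<Sum>k<n. c j * c k * (\<integral>s. s ^ norm2_sq (fmult (finv (x j)) (x k)) \<partial>\<mu>)) =
      (\<integral>s. (\<Sum>j<n. \<Sum>k<n. c j * c k * s ^ norm2_sq (fmult (finv (x j)) (x k))) \<partial>\<mu>)"
    by (simp add: integrable_power_pm1[OF assms])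
  also have "\<dots> \<ge> 0"
    by (rule Bochner_Integration.integral_nonneg)
       (auto simp: space_pm1[OF assms] intro!: psd_onD[OF psd_on_power_norm2_sq])
  finally show "0 \<le> (\<Sum>j<n. \<Sum>k<n. c j * c k * (\<integral>s. s ^ norm2_sq (fmult (finv (x j)) (x k)) \<partial>\<mu>))" .
qed

theorem theorem1p2:
  fixes \<phi> :: "fgroup \<Rightarrow> real"
  assumes radial: "\<And>g h. norm2 g = norm2 h \<Longrightarrow> \<phi> g = \<phi> h"
    and unit: "\<phi> fone = 1"
  shows "(positive_definite (\<lambda>g. complex_of_real (\<phi> g)) \<longleftrightarrow>
           (\<exists>\<mu> :: real measure. prob_space \<mu> \<and>
              sets \<mu> = sets (restrict_space borel {-1..1}) \<and>
              (\<forall>g. \<phi> g = (\<integral>s. s ^ norm2_sq g \<partial>\<mu>))))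
       \<and> (\<forall>\<mu> \<nu> :: real measure.
            (prob_space \<mu> \<and> sets \<mu> = sets (restrict_space borel {-1..1}) \<and>
               (\<forall>g. \<phi> g = (\<integral>s. s ^ norm2_sq g \<partial>\<mu>))) \<longrightarrow>
            (prob_space \<nu> \<and> sets \<nu> = sets (restrict_space borel {-1..1}) \<and>
               (\<forall>g. \<phi> g = (\<integral>s. s ^ norm2_sq g \<partial>\<nu>))) \<longrightarrow>
            \<mu> = \<nu>)"
proof -
  \<comment> \<open>\<open>w n\<close> is a word of squared norm \<open>n\<close>, so the radial
    function is \<open>f\<close> of the squared norm.\<close>
  define w where "w n = Abs_fgroup (fresh_word 0 n)" for n
  define f where "f n = \<phi> (w n)" for n
  have norm_w: "norm2_sq (w n) = n" for n
    unfolding norm2_sq_eq_wsq w_def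
    by (subst Abs_fgroup_inverse) (simp_all add: reduced_fresh_word wsq_fresh_word)
  have \<phi>: "\<phi> = (\<lambda>g. f (norm2_sq g))"
    unfolding f_def by (intro ext radial) (simp add: norm2_def norm_w)
  have f_0: "f 0 = 1" using unit by (simp add: f_def w_def fone_def fresh_word_def)
  have pd_iff: "positive_definite (\<lambda>g. complex_of_real (\<phi> g)) \<longleftrightarrow>
      psd_on UNIV (\<lambda>x y. f (norm2_sq (fmult (finv x) y)))"
    unfolding \<phi> by (rule positive_definite_of_real_iff) (simp add: norm2_sq_finv_mult_commute)
  \<comment> \<open>As every natural number is a squared norm, representing \<phi> amounts to the
    moment problem for \<open>f\<close>, for existence and for uniqueness.\<close>
  have moments_iff: "(\<forall>g. \<phi> g = (\<integral>s. s ^ norm2_sq g \<partial>\<mu>)) \<longleftrightarrow> (\<forall>n. f n = (\<integral>s. s ^ n \<partial>\<mu>))" for \<mu> :: "real measure"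
    unfolding \<phi> by (metis norm_w)
  show ?thesis unfolding pd_iff moments_iff
  proof (intro conjI iffI allI impI)
    assume psd: "psd_on UNIV (\<lambda>x y. f (norm2_sq (fmult (finv x) y)))"
    interpret bounded_hankel f
      using hankel_psd_if_radial_psd[OF psd] bounded_if_radial_psd[OF psd f_0] f_0
      by unfold_locales
    show "\<exists>\<mu> :: real measure. prob_space \<mu> \<and> sets \<mu> = sets (restrict_space borel {-1..1}) \<and>
        (\<forall>n. f n = (\<integral>s. s ^ n \<partial>\<mu>))"
      by (rule representing_measure)
  next
    assume "\<exists>\<mu> :: real measure. prob_space \<mu> \<and> sets \<mu> = sets (restrict_space borel {-1..1}) \<and>
        (\<forall>n. f n = (\<integral>s. s ^ n \<partial>\<mu>))"
    then obtain \<mu> :: "real measure" where "prob_space \<mu>" "sets \<mu> = sets (restrict_space borel {-1..1})"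
      and f: "\<And>n. f n = (\<integral>s. s ^ n \<partial>\<mu>)" by blast
    then show "psd_on UNIV (\<lambda>x y. f (norm2_sq (fmult (finv x) y)))"
      unfolding f by (intro psd_radial_moments)
  next
    fix \<mu> \<nu> :: "real measure"
    assume "prob_space \<mu> \<and> sets \<mu> = sets (restrict_space borel {-1..1}) \<and> (\<forall>n. f n = (\<integral>s. s ^ n \<partial>\<mu>))"
      and "prob_space \<nu> \<and> sets \<nu> = sets (restrict_space borel {-1..1}) \<and> (\<forall>n. f n = (\<integral>s. s ^ n \<partial>\<nu>))"
    then show "\<mu> = \<nu>" by (intro moments_unique_on_pm1) metis+
  qed
qed

end
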